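(* For all $n\ge 1$ and $k\in[n]$, the left-to-right code $\psi$ restricts to a bijection from $\mathcal{DU}_{n,k}$ onto $\mathcal{ES}_{n,k}$. Consequently $|\mathcal{ES}_{n,k}|=E_{n,k}$ for all $1\le k\le n$.
   Context: $[n]=\{1,\dots,n\}$. For a finite set $I\subset\mathbb{N}$, a down-up permutation of $I$ is a word $\pi=\pi_1\cdots\pi_m$ using each element of $I$ once with $\pi_1>\pi_2<\pi_3>\cdots$. $\mathcal{DU}_n$ is the set of down-up permutations of $[n]$, $\mathcal{DU}_{n,k}$ the subset with $\pi_1=k$, and $E_{n,k}=|\mathcal{DU}_{n,k}|$. Left-to-right code $\psi(\pi)$ of $\pi\in\mathcal{DU}_n$: start with $I=[n]$, the word $\pi$ and the empty sequence $\Delta$. While $|I|\ge 2$: if some $a\in I$ satisfies $\pi_1>a>\pi_2$, let $a'$ be the largest such $a$, append the domino $(\pi_1,a')$ to $\Delta$, and replace $\pi$ by the word obtained by exchanging the values $\pi_1$ and $a'$ (the result is again down-up on $I$); otherwise append the starred domino $(\pi_1,\pi_2)^*$ to $\Delta$, delete the first two letters of $\pi$ and remove $\pi_1,\pi_2$ from $I$. If finally $I=\{a\}$ is a singleton, append $(a)^*$ and stop (this happens with $a=n$). Then $\psi(\pi)=\Delta$. A domino on $[n]$ is an ordered pair $(j,i)$ with $1\le i<j\le n$; a starred domino on $[n]$ is $(j,i)^*$ with $1\le i<j\le n$, or $(n)^*=(n,n)^*$. A word $\Delta=\Delta_1\cdots\Delta_r$ of dominos and starred dominos is an encoding sequence of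 $[n]$ if: (i) the entries of the starred dominos are pairwise disjoint and their union is $[n]$; (ii) if $\Delta_\ell=(j,i)^*$, then the next letter (if any) has first entry $>i$, and no entry of any later letter lies strictly between $i$ and $j$; (iii) if $\Delta_\ell=(j,i)$, then both $i$ and $j$ appear in some later letter, $i$ is the first entry of the next letter, and each integer strictly between $i$ and $j$ appears in an earlier starred domino. $\mathcal{ES}_{n,k}$ is the set of encoding sequences of $[n]$ whose first letter has first entry $k$ (for $k\ge2$ these are exactly those starting with $(k,k-1)$ or $(k,k-1)^*$). *)

theory Defs
  imports Main "HOL-Combinatorics.Transposition"
begin

text \<open>
  Words are lists, so the letter written \<open>\<pi>\<^sub>i\<close> (indices from 1) is \<open>w ! (i - 1)\<close>: descents occur at
  the even list positions.
\<close>

definition down_up_perm :: "nat set \<Rightarrow> nat list \<Rightarrow> bool" where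
  "down_up_perm I w \<longleftrightarrow> distinct w \<and> set w = I \<and>
     (\<forall>i. Suc i < length w \<longrightarrow> (if even i then w ! i > w ! Suc i else w ! i < w ! Suc i))"

definition DU :: "nat \<Rightarrow> nat list set" where
  "DU n = {w. down_up_perm {1..n} w}"

definition DU_first :: "nat \<Rightarrow> nat \<Rightarrow> nat list set" where
  "DU_first n k = {w \<in> DU n. w \<noteq> [] \<and> hd w = k}"

definition entringer :: "nat \<Rightarrow> nat \<Rightarrow> nat" where
  "entringer n k = card (DU_first n k)"

text \<open>
  \<open>Domino j i\<close> is \<open>(j,i)\<close>, \<open>Starred j i\<close> is \<open>(j,i)\<^sup>*\<close>, and \<open>(a)\<^sup>*\<close> is \<open>(a,a)\<^sup>*\<close>, that is
  \<open>Starred a a\<close>.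
\<close>

datatype letter =
    Domino (first_entry: nat) (second_entry: nat)
  | is_Starred: Starred (first_entry: nat) (second_entry: nat)

definition entries :: "letter \<Rightarrow> nat set" where
  "entries d = {first_entry d, second_entry d}"

text \<open>
  The current index set \<open>I\<close> is always the set of letters of the current word, so only the word is
  carried along.  Exchanging the values \<open>x\<close> and \<open>a\<close> in a word maps \<open>transpose x a\<close> over it.
\<close>

function psi :: "nat list \<Rightarrow> letter list" where
  "psi [] = []"
| "psi [a] = [Starred a a]"
| "psi (x # y # w) =
     (if \<exists>a \<in> set (x # y # w). x > a \<and> a > y
      then let a' = Max {a \<in> set (x # y # w). x > a \<and> a > y}
           in Domino x a' # psi (map (transpose x a') (x # y # w))
      else Starred x y # psi w)"
  by pat_completeness auto

termination
proof (relation "measures [length, hd]")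
  fix x y :: nat and w :: "nat list" and a'
  assume ex: "\<exists>a \<in> set (x # y # w). x > a \<and> a > y"
    and a': "a' = Max {a \<in> set (x # y # w). x > a \<and> a > y}"
  have "finite {a \<in> set (x # y # w). x > a \<and> a > y}"
    by (rule finite_subset[of _ "set (x # y # w)"]) auto
  moreover have "{a \<in> set (x # y # w). x > a \<and> a > y} \<noteq> {}"
    using ex by blast
  ultimately have "a' \<in> {a \<in> set (x # y # w). x > a \<and> a > y}"
    unfolding a' by (rule Max_in)
  then have "a' < x" by blast
  then show "(map (transpose x a') (x # y # w), x # y # w) \<in> measures [length, hd]"
    by simp
qed auto

definition letter_on :: "nat \<Rightarrow> letter \<Rightarrow> bool" where
  "letter_on n d \<longleftrightarrow>
     (\<exists>j i. 1 \<le> i \<and> i < j \<and> j \<le> n \<and> (d = Domino j i \<or> d = Starred j i)) \<or> d = Starred n n"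

text \<open>
  Disjointness is required of starred dominos at different positions, so a starred
  domino cannot be repeated.
\<close>

definition starred_partition :: "nat \<Rightarrow> letter list \<Rightarrow> bool" where
  "starred_partition n D \<longleftrightarrow>
     (\<forall>l < length D. \<forall>m < length D. l \<noteq> m \<longrightarrow> is_Starred (D ! l) \<longrightarrow> is_Starred (D ! m) \<longrightarrow>
        entries (D ! l) \<inter> entries (D ! m) = {}) \<and>
     (\<Union>d \<in> {d \<in> set D. is_Starred d}. entries d) = {1..n}"

definition starred_condition :: "letter list \<Rightarrow> bool" where
  "starred_condition D \<longleftrightarrow>
     (\<forall>l < length D. \<forall>j i. D ! l = Starred j i \<longrightarrow>
        (Suc l < length D \<longrightarrow> first_entry (D ! Suc l) > i) \<and>
        (\<forall>m. l < m \<and> m < length D \<longrightarrow> (\<forall>e \<in> entries (D ! m). \<not> (i < e \<and> e < j))))"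

definition unstarred_condition :: "letter list \<Rightarrow> bool" where
  "unstarred_condition D \<longleftrightarrow>
     (\<forall>l < length D. \<forall>j i. D ! l = Domino j i \<longrightarrow>
        (\<exists>m. l < m \<and> m < length D \<and> i \<in> entries (D ! m)) \<and>
        (\<exists>m. l < m \<and> m < length D \<and> j \<in> entries (D ! m)) \<and>
        (Suc l < length D \<and> first_entry (D ! Suc l) = i) \<and>
        (\<forall>e. i < e \<and> e < j \<longrightarrow> (\<exists>m < l. is_Starred (D ! m) \<and> e \<in> entries (D ! m))))"

definition encoding_sequence :: "nat \<Rightarrow> letter list \<Rightarrow> bool" where
  "encoding_sequence n D \<longleftrightarrow>
     (\<forall>d \<in> set D. letter_on n d) \<and>
     starred_partition n D \<and> starred_condition D \<and> unstarred_condition D"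

definition ES_first :: "nat \<Rightarrow> nat \<Rightarrow> letter list set" where
  "ES_first n k = {D. encoding_sequence n D \<and> D \<noteq> [] \<and> first_entry (hd D) = k}"

end

theory Submission
  imports Defs
begin

text \<open>
  If the first letter of a word is \<open>x\<close>, the first letter of its code is \<open>(x,a)\<close> or \<open>(x,a)\<^sup>*\<close>, where
  \<open>a\<close> is the predecessor of \<open>x\<close> among the letters of the word.  So a code is read backwards by
  undoing one exchange or prepending two letters at a time.  On the other side, the conditions
  defining an encoding sequence are equivalent to local ones relating each letter only to the set
  of starred entries of the remaining sequence, which is the set of letters of the current word.
\<close>

section \<open>Down-up words\<close>

text \<open>Deleting two letters preserves the parity of positions, so the tail is again down-up;
  this matches the deletion made for a starred domino.\<close>

lemma down_up_perm_Cons_Cons: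
  "down_up_perm I (x # y # w) \<longleftrightarrow>
     y < x \<and> (w \<noteq> [] \<longrightarrow> y < hd w) \<and> x \<notin> set w \<and> y \<notin> set w \<and>
     I = insert x (insert y (set w)) \<and> down_up_perm (set w) w"
proof -
  let ?R = "\<lambda>u i. if even i then u ! i > u ! Suc i else u ! i < u ! Suc (i::nat)"
  have "(\<forall>i. Suc i < length (x # y # w) \<longrightarrow> ?R (x # y # w) i) \<longleftrightarrow>
        ?R (x # y # w) 0 \<and> (w \<noteq> [] \<longrightarrow> ?R (x # y # w) 1) \<and>
        (\<forall>i. Suc i < length w \<longrightarrow> ?R (x # y # w) (Suc (Suc i)))" (is "?L \<longleftrightarrow> ?M")
  proof
    assume L: ?L
    have "?R (x # y # w) 0" using L[rule_format, of 0] by simp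
    moreover have "w \<noteq> [] \<longrightarrow> ?R (x # y # w) 1" using L[rule_format, of 1] by simp
    moreover have "\<forall>i. Suc i < length w \<longrightarrow> ?R (x # y # w) (Suc (Suc i))"
      using L by (metis Suc_less_eq length_Cons)
    ultimately show ?M by blast
  next
    assume M: ?M
    show ?L
    proof (intro allI impI)
      fix i assume "Suc i < length (x # y # w)"
      then show "?R (x # y # w) i"
        using M by (cases i; cases "i - 1") auto
    qed
  qed
  then show ?thesis
    unfolding down_up_perm_def by (auto simp: hd_conv_nth)
qed

text \<open>\<open>p\<close> and \<open>q\<close> are neighbouring values of \<open>I\<close>, so
  the exchange is monotone on the letters other than \<open>p\<close>. As \<open>p\<close> occurs
  only in front, the one remaining comparison is with \<open>y\<close>. The gap hypothesis is
  symmetric, which serves both encoding (\<open>q < p\<close>) and decoding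
  (\<open>p < q\<close>).\<close>

lemma down_up_perm_transpose:
  assumes du: "down_up_perm I (p # y # w)" and q: "q \<in> I" "y < q" "p \<noteq> q"
    and gap: "\<forall>e \<in> I. \<not> (p < e \<and> e < q) \<and> \<not> (q < e \<and> e < p)"
  shows "down_up_perm I (map (transpose p q) (p # y # w))"
proof -
  let ?t = "transpose p q" and ?v = "p # y # w"
  have p: "y < p" "p \<in> I" and I: "set ?v = I" "distinct ?v"
    using du by (auto simp: down_up_perm_Cons_Cons down_up_perm_def)
  have mono: "?t u < ?t v" if "u \<in> I" "v \<in> I" "u \<noteq> p" "v \<noteq> p" "u < v" for u v
    using that gap q by (auto simp: transpose_def)
  have steps: "if even i then ?t (?v ! i) > ?t (?v ! Suc i) else ?t (?v ! i) < ?t (?v ! Suc i)"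
    if i: "Suc i < length ?v" for i
  proof (cases i)
    case 0
    then show ?thesis using p q by (simp add: transpose_def)
  next
    case (Suc m)
    have "?v ! i \<in> set ?v" "?v ! Suc i \<in> set ?v"
      using i by (meson Suc_lessD nth_mem)+
    then have in_I: "?v ! i \<in> I" "?v ! Suc i \<in> I"
      using I(1) by blast+
    have "?v ! i \<noteq> ?v ! 0" "?v ! Suc i \<noteq> ?v ! 0"
      using I(2) i Suc by (metis Suc_lessD nat.distinct(1) nth_eq_iff_index_eq zero_less_Suc less_trans)+
    then have ne: "?v ! i \<noteq> p" "?v ! Suc i \<noteq> p" by simp_all
    show ?thesis
      using du i mono in_I ne unfolding down_up_perm_def by presburger
  qed
  have "?t ` I = I"
    using p q by (simp add: transpose_image_eq)
  then have "set (map ?t ?v) = I"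
    using I(1) by (metis set_map)
  moreover have "distinct (map ?t ?v)"
    using I(2) by (metis distinct_map inj_on_subset inj_transpose subset_UNIV)
  moreover have "\<forall>i. Suc i < length (map ?t ?v) \<longrightarrow>
      (if even i then map ?t ?v ! i > map ?t ?v ! Suc i else map ?t ?v ! i < map ?t ?v ! Suc i)"
    using steps by (metis Suc_lessD length_map nth_map)
  ultimately show ?thesis
    unfolding down_up_perm_def by blast
qed

section \<open>Steps of the code as exchanges with a predecessor\<close>

lemma psi_Domino:
  assumes "a \<in> set (x # y # w)" "y < a" "a < x" "\<forall>e \<in> set (x # y # w). \<not> (a < e \<and> e < x)"
  shows "psi (x # y # w) = Domino x a # psi (map (transpose x a) (x # y # w))"
proof -
  have "Max {b \<in> set (x # y # w). x > b \<and> b > y} = a"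
    using assms by (intro Max_eqI) (auto simp: not_less)
  moreover have "\<exists>a \<in> set (x # y # w). x > a \<and> a > y"
    using assms by blast
  ultimately show ?thesis by (simp only: psi.simps Let_def if_True)
qed

lemma psi_Starred:
  assumes "\<forall>e \<in> set (x # y # w). \<not> (y < e \<and> e < x)"
  shows "psi (x # y # w) = Starred x y # psi w"
proof -
  have "\<not> (\<exists>a \<in> set (x # y # w). x > a \<and> a > y)"
    using assms by blast
  then show ?thesis by (simp only: psi.simps if_False)
qed

text \<open>The letter chosen by \<open>Max\<close> is the predecessor of \<open>x\<close> in
  \<open>I\<close>, a description free of \<open>y\<close>. After an exchange the down-up property
  is supplied too, so that an induction along \<open>psi\<close> can continue.\<close>

lemma psi_cases [consumes 1, case_names Nil single Domino Starred]:
  assumes "down_up_perm I w"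
  obtains "w = []" "I = {}"
  | a where "w = [a]" "I = {a}"
  | x y u a where "w = x # y # u" "a \<in> I" "y < a" "a < x" "\<forall>e \<in> I. \<not> (a < e \<and> e < x)"
      "psi w = Domino x a # psi (map (transpose x a) w)" "down_up_perm I (map (transpose x a) w)"
  | x y u where "w = x # y # u" "\<forall>e \<in> I. \<not> (y < e \<and> e < x)"
      "psi w = Starred x y # psi u"
proof -
  have I: "set w = I" using assms by (simp add: down_up_perm_def)
  consider "w = []" | a where "w = [a]" | x y u where "w = x # y # u"
    by (metis list.exhaust)
  then show thesis
  proof cases
    case 3
    let ?A = "{a \<in> I. y < a \<and> a < x}"
    have fin: "finite ?A" by (rule finite_subset[of _ "set w"]) (use I in auto)
    show thesis
    proof (cases "?A = {}")
      case True
      then show thesis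
        using that(4) 3 psi_Starred[of x y u] I by blast
    next
      case False
      define a where "a = Max ?A"
      have a: "a \<in> I" "y < a" "a < x"
        using Max_in[OF fin False] a_def by blast+
      have gap: "\<not> (a < e \<and> e < x)" if "e \<in> I" for e
        using Max_ge[OF fin, of e] that a unfolding a_def by fastforce
      have "psi w = Domino x a # psi (map (transpose x a) w)"
        using psi_Domino[of a x y u] a gap I 3 by blast
      moreover have "down_up_perm I (map (transpose x a) w)"
        using down_up_perm_transpose[of I x y u a] assms a gap 3 by auto
      ultimately show thesis using that(3) 3 a gap by blast
    qed
  qed (use I that in auto)
qed

section \<open>Local conditions and decoding\<close>

definition starred_entries :: "letter list \<Rightarrow> nat set" where
  "starred_entries D = (\<Union>d \<in> {d \<in> set D. is_Starred d}. entries d)"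

lemma starred_entries_simps [simp]:
  "starred_entries [] = {}"
  "starred_entries (Starred j i # D) = insert i (insert j (starred_entries D))"
  "starred_entries (Domino j i # D) = starred_entries D"
  by (auto simp: starred_entries_def entries_def)

text \<open>\<open>starred_entries D\<close> stands for the letters of the word left after the first
  step. The \<open>hd D\<close> in the last clause is meaningful, since
  \<open>i \<in> starred_entries D\<close> excludes \<open>D = []\<close>.\<close>

fun is_code :: "letter list \<Rightarrow> bool" where
  "is_code [] \<longleftrightarrow> True"
| "is_code (Starred j i # D) \<longleftrightarrow>
     (if i = j then D = []
      else i < j \<and> i \<notin> starred_entries D \<and> j \<notin> starred_entries D \<and>
        (\<forall>e \<in> starred_entries D. \<not> (i < e \<and> e < j)) \<and>
        (D \<noteq> [] \<longrightarrow> i < first_entry (hd D)) \<and> is_code D)"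
| "is_code (Domino j i # D) \<longleftrightarrow>
     i < j \<and> i \<in> starred_entries D \<and> j \<in> starred_entries D \<and>
     (\<forall>e \<in> starred_entries D. \<not> (i < e \<and> e < j)) \<and> first_entry (hd D) = i \<and> is_code D"

fun decode :: "letter list \<Rightarrow> nat list" where
  "decode [] = []"
| "decode (Starred j i # D) = (if i = j then [j] else j # i # decode D)"
| "decode (Domino j i # D) = map (transpose j i) (decode D)"

text \<open>The claims are proved together because \<open>is_code\<close> tests the starred entries
  and the first entry of the remaining code. \<open>I\<close> is arbitrary because deletions need
  not leave an initial segment.\<close>

lemma psi_code:
  assumes "down_up_perm I w"
  shows "is_code (psi w) \<and> starred_entries (psi w) = I \<and> decode (psi w) = w \<and>
    (psi w = [] \<longleftrightarrow> w = []) \<and> (w \<noteq> [] \<longrightarrow> first_entry (hd (psi w)) = hd w)"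
  using assms
\<comment> \<open>The measure is that of the termination of \<open>psi\<close>: an exchange keeps
  the length and lowers the first letter, a deletion shortens the word.\<close>
proof (induction w arbitrary: I rule: wf_induct_rule[OF wf_measures[of "[length, hd]"]])
  case (1 w)
  from 1(2) show ?case
  proof (cases rule: psi_cases)
    case (Domino x y u a)
    let ?v = "map (transpose x a) w"
    have IH: "is_code (psi ?v) \<and> starred_entries (psi ?v) = I \<and> decode (psi ?v) = ?v \<and>
        first_entry (hd (psi ?v)) = a"
      using 1(1)[of ?v I] Domino by simp
    have "x \<in> I" using 1(2) Domino(1) by (auto simp: down_up_perm_def)
    moreover have "map (transpose x a) ?v = w" by (simp add: comp_def)
    ultimately show ?thesis
      using Domino(1-5) IH unfolding Domino(6) by simp
  next
    case (Starred x y u)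
    have du: "y < x" "u \<noteq> [] \<longrightarrow> y < hd u" "x \<notin> set u" "y \<notin> set u"
        "I = insert x (insert y (set u))" "down_up_perm (set u) u"
      using 1(2) Starred(1) by (auto simp: down_up_perm_Cons_Cons)
    have "is_code (psi u) \<and> starred_entries (psi u) = set u \<and> decode (psi u) = u \<and>
        (psi u = [] \<longleftrightarrow> u = []) \<and> (u \<noteq> [] \<longrightarrow> first_entry (hd (psi u)) = hd u)"
      using 1(1)[OF _ du(6)] Starred(1) by simp
    then show ?thesis
      using du(1-5) Starred(1,2) unfolding Starred(3) by auto
  qed auto
qed

text \<open>The clauses of \<open>is_code\<close> are what makes each undone step yield a down-up
  word and makes \<open>psi\<close> choose that same step again.\<close>

lemma decode_down_up_perm:
  assumes "is_code D"
  shows "down_up_perm (starred_entries D) (decode D) \<and> psi (decode D) = D \<and>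
    (D \<noteq> [] \<longrightarrow> decode D \<noteq> [] \<and> hd (decode D) = first_entry (hd D))"
  using assms
proof (induction D rule: is_code.induct)
  case 1
  show ?case by (simp add: down_up_perm_def)
next
  case (2 j i D)
  show ?case
  proof (cases "i = j")
    case True
    then show ?thesis using 2(2) by (simp add: down_up_perm_def)
  next
    case False
    then have IH: "down_up_perm (starred_entries D) (decode D)" "psi (decode D) = D"
        "D \<noteq> [] \<longrightarrow> decode D \<noteq> [] \<and> hd (decode D) = first_entry (hd D)"
      using 2 by auto
    have set: "set (decode D) = starred_entries D"
      using IH(1) by (simp add: down_up_perm_def)
    have "down_up_perm (starred_entries (Starred j i # D)) (j # i # decode D)"
      using 2(2) False IH set by (auto simp: down_up_perm_Cons_Cons)
    moreover have "psi (j # i # decode D) = Starred j i # D"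
      using psi_Starred[of j i "decode D"] 2(2) False IH(2) set by auto
    ultimately show ?thesis using False by simp
  qed
next
  case (3 j i D)
  let ?I = "starred_entries D"
  have IH: "down_up_perm ?I (decode D)" "psi (decode D) = D"
      "decode D \<noteq> [] \<and> hd (decode D) = i"
    and ij: "i < j" "i \<in> ?I" "j \<in> ?I" "\<forall>e \<in> ?I. \<not> (i < e \<and> e < j)"
    using 3 by auto
  have set: "set (decode D) = ?I"
    using IH(1) by (simp add: down_up_perm_def)
  \<comment> \<open>The decoded word contains the distinct values \<open>i\<close> and
    \<open>j\<close>, so a second letter exists after \<open>i\<close>.\<close>
  obtain y u where v: "decode D = i # y # u"
  proof (cases "decode D")
    case (Cons a v)
    then show ?thesis using that IH(3) ij set by (cases v) auto
  qed (use IH in simp)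
  have y: "y < i" using IH(1) by (simp add: v down_up_perm_Cons_Cons)
  have du: "down_up_perm ?I (map (transpose j i) (decode D))"
    using down_up_perm_transpose[of ?I i y u j] IH(1) ij y
    by (auto simp: v transpose_commute)
  define u' where "u' = map (transpose j i) u"
  have v': "map (transpose j i) (decode D) = j # y # u'"
    using y ij(1) by (simp add: v u'_def)
  \<comment> \<open>The exchange keeps the letter set, so \<open>i\<close> is still the predecessor
    of \<open>j\<close> and lies above \<open>y\<close>: \<open>psi\<close> picks exactly this
    exchange and reverts it.\<close>
  have "set (j # y # u') = ?I"
    using du v' by (simp add: down_up_perm_def)
  then have "psi (j # y # u') = Domino j i # psi (map (transpose j i) (j # y # u'))"
    using ij y by (intro psi_Domino) auto
  also have "map (transpose j i) (j # y # u') = decode D"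
    unfolding v'[symmetric] by (simp add: comp_def)
  finally show ?case
    using du v' IH(2) by simp
qed

section \<open>Encoding sequences\<close>

definition all_entries :: "letter list \<Rightarrow> nat set" where
  "all_entries D = (\<Union>d \<in> set D. entries d)"

lemma all_entries_simps [simp]:
  "all_entries [] = {}"
  "all_entries (d # D) = entries d \<union> all_entries D"
  by (auto simp: all_entries_def)

lemma entries_simps [simp]:
  "entries (Domino j i) = {j, i}" "entries (Starred j i) = {j, i}"
  by (auto simp: entries_def)

lemma in_all_entries_nth: "e \<in> all_entries D \<longleftrightarrow> (\<exists>m < length D. e \<in> entries (D ! m))"
  unfolding all_entries_def by (metis UN_iff in_set_conv_nth)

lemma in_starred_entries_nth:
  "e \<in> starred_entries D \<longleftrightarrow> (\<exists>m < length D. is_Starred (D ! m) \<and> e \<in> entries (D ! m))"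
  unfolding starred_entries_def
  by (auto simp: in_set_conv_nth)

text \<open>An unstarred domino contributes nothing new: its clause in \<open>is_code\<close> puts
  both entries among the starred ones that follow.\<close>

lemma all_entries_eq_starred_entries: "is_code D \<Longrightarrow> all_entries D = starred_entries D"
  by (induction D rule: is_code.induct) (auto split: if_splits)

text \<open>The half of \<open>starred_partition\<close> that passes to suffixes; the union
  condition does not, and is kept apart.\<close>

definition starred_disjoint :: "letter list \<Rightarrow> bool" where
  "starred_disjoint D \<longleftrightarrow>
     (\<forall>l < length D. \<forall>m < length D. l \<noteq> m \<longrightarrow> is_Starred (D ! l) \<longrightarrow> is_Starred (D ! m) \<longrightarrow>
        entries (D ! l) \<inter> entries (D ! m) = {})"

lemma starred_disjoint_Nil [simp]: "starred_disjoint []"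
  by (simp add: starred_disjoint_def)

lemma starred_disjoint_Cons [simp]:
  "starred_disjoint (d # D) \<longleftrightarrow>
     (is_Starred d \<longrightarrow> entries d \<inter> starred_entries D = {}) \<and> starred_disjoint D"
  unfolding starred_disjoint_def
  by (simp add: All_less_Suc2 set_eq_iff in_starred_entries_nth) blast

lemma starred_condition_Nil [simp]: "starred_condition []"
  by (simp add: starred_condition_def)

lemma starred_condition_Cons [simp]:
  "starred_condition (d # D) \<longleftrightarrow>
     (\<forall>j i. d = Starred j i \<longrightarrow> (D \<noteq> [] \<longrightarrow> i < first_entry (hd D)) \<and>
        (\<forall>e \<in> all_entries D. \<not> (i < e \<and> e < j))) \<and> starred_condition D"
proof -
  have later: "(\<forall>m. l < m \<and> m < Suc n \<longrightarrow> P m) \<longleftrightarrow> (\<forall>m. l \<le> m \<and> m < n \<longrightarrow> P (Suc m))"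
    for l n and P :: "nat \<Rightarrow> bool"
    by (metis Suc_le_lessD Suc_less_eq less_Suc_eq_le not_less_zero old.nat.exhaust)
  show ?thesis
    unfolding starred_condition_def in_all_entries_nth Bex_def Ball_def
    by (simp add: All_less_Suc2 later hd_conv_nth Suc_le_eq) blast
qed

text \<open>
  Condition (iii) for a suffix of an encoding sequence: the integers outside \<open>I\<close> are the ones that
  starred dominos before the suffix have used.
\<close>

definition unstarred_condition_on :: "nat set \<Rightarrow> letter list \<Rightarrow> bool" where
  "unstarred_condition_on I D \<longleftrightarrow>
     (\<forall>l < length D. \<forall>j i. D ! l = Domino j i \<longrightarrow>
        (\<exists>m. l < m \<and> m < length D \<and> i \<in> entries (D ! m)) \<and>
        (\<exists>m. l < m \<and> m < length D \<and> j \<in> entries (D ! m)) \<and>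
        (Suc l < length D \<and> first_entry (D ! Suc l) = i) \<and>
        (\<forall>e \<in> I. i < e \<and> e < j \<longrightarrow> (\<exists>m < l. is_Starred (D ! m) \<and> e \<in> entries (D ! m))))"

lemma unstarred_condition_on_Nil [simp]: "unstarred_condition_on I []"
  by (simp add: unstarred_condition_on_def)

text \<open>Nothing precedes the first letter, so its interval must miss \<open>I\<close>
  altogether. A starred first letter precedes the whole tail and settles the requirement for its own
  entries: hence \<open>I - entries d\<close>.\<close>

lemma unstarred_condition_on_Cons [simp]:
  "unstarred_condition_on I (d # D) \<longleftrightarrow>
     (\<forall>j i. d = Domino j i \<longrightarrow> i \<in> all_entries D \<and> j \<in> all_entries D \<and>
        first_entry (hd D) = i \<and> (\<forall>e \<in> I. \<not> (i < e \<and> e < j))) \<and>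
     unstarred_condition_on (if is_Starred d then I - entries d else I) D"
proof -
  have later: "(\<exists>m. l < m \<and> m < Suc n \<and> P m) \<longleftrightarrow> (\<exists>m. l \<le> m \<and> m < n \<and> P (Suc m))"
    for l n and P :: "nat \<Rightarrow> bool"
    by (metis Suc_le_lessD Suc_less_eq less_Suc_eq_le not_less_zero old.nat.exhaust)
  let ?C = "\<lambda>I D l. \<forall>j i. D ! l = Domino j i \<longrightarrow>
      (\<exists>m. l < m \<and> m < length D \<and> i \<in> entries (D ! m)) \<and>
      (\<exists>m. l < m \<and> m < length D \<and> j \<in> entries (D ! m)) \<and>
      (Suc l < length D \<and> first_entry (D ! Suc l) = i) \<and>
      (\<forall>e \<in> I. i < e \<and> e < j \<longrightarrow> (\<exists>m < l. is_Starred (D ! m) \<and> e \<in> entries (D ! m)))"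
  let ?J = "if is_Starred d then I - entries d else I"
  have "?C I (d # D) 0 \<longleftrightarrow> (\<forall>j i. d = Domino j i \<longrightarrow> i \<in> all_entries D \<and> j \<in> all_entries D \<and>
      first_entry (hd D) = i \<and> (\<forall>e \<in> I. \<not> (i < e \<and> e < j)))"
  proof (cases "D = []")
    case False
    then show ?thesis
      by (auto simp: later in_all_entries_nth hd_conv_nth)
  qed (simp add: later)
  moreover have "?C I (d # D) (Suc l) \<longleftrightarrow> ?C ?J D l" for l
    by (cases "is_Starred d") (simp_all add: later Suc_le_eq Ex_less_Suc2 imp_conjL, blast)
  ultimately show ?thesis
    unfolding unstarred_condition_on_def length_Cons All_less_Suc2 by simp
qed

section \<open>Equivalence of the global and the local conditions\<close>

lemma is_code_if_conditions:
  assumes "\<forall>d \<in> set D. letter_on n d" "starred_disjoint D" "starred_condition D"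
    "unstarred_condition_on (starred_entries D) D"
  shows "is_code D"
  using assms
proof (induction D)
  case (Cons d D)
  show ?case
  proof (cases d)
    case (Domino j i)
    with Cons have "is_code D" by simp
    with Cons Domino show ?thesis
      by (auto simp: all_entries_eq_starred_entries letter_on_def)
  next
    case (Starred j i)
    \<comment> \<open>By disjointness, the index set left after this domino is the one that the
      induction hypothesis asks for.\<close>
    have "insert i (insert j (starred_entries D)) - {j, i} = starred_entries D"
      using Cons.prems(2) Starred by auto
    with Cons Starred have code: "is_code D" by simp
    show ?thesis
    proof (cases "i = j")
      case True
      then have "j = n" using Cons.prems(1) Starred by (auto simp: letter_on_def)
      have "D = []"
      proof (rule ccontr)
        assume "D \<noteq> []"
        then have "n < first_entry (hd D)" "letter_on n (hd D)"
          using Cons.prems Starred True \<open>j = n\<close> by auto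
        then show False by (auto simp: letter_on_def)
      qed
      with True Starred show ?thesis by simp
    next
      case False
      then have "i < j" using Cons.prems(1) Starred by (auto simp: letter_on_def)
      then show ?thesis
        using Cons.prems Starred code by (auto simp: all_entries_eq_starred_entries)
    qed
  qed
qed simp

text \<open>
  Here \<open>n\<close> survives until the last letter, because a starred domino containing it cannot be
  followed by a letter with a larger first entry.
\<close>

lemma conditions_if_is_code:
  assumes "is_code D" "starred_entries D \<subseteq> {1..n}" "D \<noteq> [] \<longrightarrow> n \<in> starred_entries D"
  shows "(\<forall>d \<in> set D. letter_on n d) \<and> starred_disjoint D \<and> starred_condition D \<and>
    unstarred_condition_on (starred_entries D) D"
  using assms
proof (induction D rule: is_code.induct)
  case (2 j i D)
  show ?case
  proof (cases "i = j")
    case True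
    \<comment> \<open>Here \<open>D = []\<close>, so the hypothesis on \<open>n\<close> forces
      \<open>j = n\<close>.\<close>
    with 2 show ?thesis by (auto simp: letter_on_def)
  next
    case False
    with 2 have code: "is_code D" by simp
    \<comment> \<open>The next first entry exceeds \<open>i\<close>, is not strictly between
      \<open>i\<close> and \<open>j\<close>, and is not \<open>j\<close>; so it exceeds
      \<open>j\<close>. As it is at most \<open>n\<close>, neither \<open>i\<close> nor
      \<open>j\<close> is \<open>n\<close>.\<close>
    have n: "n \<in> starred_entries D" if "D \<noteq> []"
    proof -
      have "first_entry (hd D) \<in> all_entries D"
        using that by (cases D) (auto simp: entries_def)
      then have "first_entry (hd D) \<in> starred_entries D"
        using all_entries_eq_starred_entries[OF code] by simp
      moreover have "i < first_entry (hd D)"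
        using 2(2) False that by simp
      ultimately have "i < j" "\<not> first_entry (hd D) < j" "j \<noteq> first_entry (hd D)"
          "first_entry (hd D) \<le> n"
        using 2(2,3) False by auto
      then have "i < j" "j < first_entry (hd D)" "first_entry (hd D) \<le> n"
        by simp_all
      then show ?thesis
        using 2(4) by auto
    qed
    have "insert i (insert j (starred_entries D)) - {j, i} = starred_entries D"
      using 2(2) False by auto
    then show ?thesis
      using 2 False n code by (auto simp: letter_on_def all_entries_eq_starred_entries)
  qed
next
  case (3 j i D)
  then have "D \<noteq> []" by auto
  with 3 show ?case
    by (auto simp: letter_on_def all_entries_eq_starred_entries)
qed simp

lemma starred_partition_iff:
  "starred_partition n D \<longleftrightarrow> starred_disjoint D \<and> starred_entries D = {1..n}"
  by (simp add: starred_partition_def starred_disjoint_def starred_entries_def)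

lemma encoding_sequence_iff:
  assumes "n \<ge> 1"
  shows "encoding_sequence n D \<longleftrightarrow> is_code D \<and> starred_entries D = {1..n}"
proof -
  \<comment> \<open>Entries of letters lie in \<open>{1..n}\<close>, hence so do the integers
    between them, and restricting \<open>e\<close> to \<open>{1..n}\<close> changes nothing.\<close>
  have "unstarred_condition D \<longleftrightarrow> unstarred_condition_on {1..n} D" if "\<forall>d \<in> set D. letter_on n d"
  proof -
    have "1 \<le> i \<and> j \<le> n" if "l < length D" "D ! l = Domino j i" for l j i
      using \<open>\<forall>d \<in> set D. letter_on n d\<close> that by (metis letter.distinct(1) letter.inject(1) letter_on_def nth_mem)
    then have "e \<in> {1..n}" if "l < length D" "D ! l = Domino j i" "i < e" "e < j" for l j i e
      using that by fastforce
    then show ?thesis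
      unfolding unstarred_condition_def unstarred_condition_on_def by blast
  qed
  then have "encoding_sequence n D \<longleftrightarrow> (\<forall>d \<in> set D. letter_on n d) \<and> starred_disjoint D \<and>
      starred_entries D = {1..n} \<and> starred_condition D \<and> unstarred_condition_on (starred_entries D) D"
    unfolding encoding_sequence_def starred_partition_iff by auto
  then show ?thesis
    using is_code_if_conditions[of D n] conditions_if_is_code[of D n] assms
    by (metis atLeastAtMost_iff order_refl)
qed

theorem theorem4:
  fixes n k :: nat
  assumes "n \<ge> 1" and "k \<in> {1..n}"
  shows "bij_betw psi (DU_first n k) (ES_first n k) \<and> card (ES_first n k) = entringer n k"
proof
  show "bij_betw psi (DU_first n k) (ES_first n k)"
  \<comment> \<open>\<open>psi_code\<close> and \<open>decode_down_up_perm\<close> also track the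
    first letter, so both maps respect the restriction to \<open>k\<close>.\<close>
  proof (rule bij_betw_byWitness[where f' = decode])
    show "\<forall>w \<in> DU_first n k. decode (psi w) = w"
      using psi_code by (auto simp: DU_first_def DU_def)
    show "\<forall>D \<in> ES_first n k. psi (decode D) = D"
      using decode_down_up_perm encoding_sequence_iff[OF assms(1)] by (auto simp: ES_first_def)
    show "psi ` DU_first n k \<subseteq> ES_first n k"
      using psi_code[of "{1..n}"] encoding_sequence_iff[OF assms(1)]
      by (auto simp: DU_first_def DU_def ES_first_def)
    show "decode ` ES_first n k \<subseteq> DU_first n k"
    proof (rule image_subsetI)
      fix D assume D: "D \<in> ES_first n k"
      then have "is_code D" "starred_entries D = {1..n}"
        using encoding_sequence_iff[OF assms(1)] by (simp_all add: ES_first_def)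
      with decode_down_up_perm[of D] D show "decode D \<in> DU_first n k"
        by (simp add: DU_first_def DU_def ES_first_def)
    qed
  qed
  then show "card (ES_first n k) = entringer n k"
    unfolding entringer_def by (simp add: bij_betw_same_card)
qed

end
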